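(* Let $A$ be a finitely generated torsion-free abelian group and $B$ a nilpotent group, let $C_A\le A$ and $C_B\le B$ be subgroups, and let $\phi: C_A\to C_B$ be an isomorphism. Let $G=\{A*B;\ C_A=C_B\}$ be the generalized free product of $A$ and $B$ amalgamating $C_A$ with $C_B$ via $\phi$. Then $G$ is (residually solvable)-by-abelian-by-(finite abelian). Furthermore, $G$ is residually solvable.
   Context: The generalized free product (amalgamated product) $\{A*B;\ C_A=C_B\}$ is the quotient of the free product $A*B$ by the normal closure of the elements $c\,(\phi(c))^{-1}$, $c\in C_A$. A group $G$ is residually solvable if for every non-identity $g\in G$ there is a homomorphism from $G$ onto a solvable group under which the image of $g$ is not the identity. $G$ is (residually solvable)-by-abelian-by-(finite abelian) if $G$ has a normal subgroup $K$ with $G/K$ finite abelian, and $K$ has a normal subgroup $D$ with $K/D$ abelian and $D$ residually solvable. *)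

theory Defs
  imports "HOL-Algebra.Algebra"
begin

definition fp_words ::
    "('a, 'm) monoid_scheme \<Rightarrow> ('b, 'n) monoid_scheme \<Rightarrow> ('a + 'b) list set"
  where "fp_words A B = lists (carrier A <+> carrier B)"

inductive_set fp_rel ::
    "('a, 'm) monoid_scheme \<Rightarrow> ('b, 'n) monoid_scheme \<Rightarrow> (('a + 'b) list \<times> ('a + 'b) list) set"
  for A B where
    refl: "u \<in> fp_words A B \<Longrightarrow> (u, u) \<in> fp_rel A B"
  | sym: "(u, v) \<in> fp_rel A B \<Longrightarrow> (v, u) \<in> fp_rel A B"
  | trans: "(u, v) \<in> fp_rel A B \<Longrightarrow> (v, w) \<in> fp_rel A B \<Longrightarrow> (u, w) \<in> fp_rel A B"
  | one_l: "u \<in> fp_words A B \<Longrightarrow> v \<in> fp_words A B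
      \<Longrightarrow> (u @ [Inl \<one>\<^bsub>A\<^esub>] @ v, u @ v) \<in> fp_rel A B"
  | one_r: "u \<in> fp_words A B \<Longrightarrow> v \<in> fp_words A B
      \<Longrightarrow> (u @ [Inr \<one>\<^bsub>B\<^esub>] @ v, u @ v) \<in> fp_rel A B"
  | mult_l: "u \<in> fp_words A B \<Longrightarrow> v \<in> fp_words A B \<Longrightarrow> x \<in> carrier A \<Longrightarrow> y \<in> carrier A
      \<Longrightarrow> (u @ [Inl x, Inl y] @ v, u @ [Inl (x \<otimes>\<^bsub>A\<^esub> y)] @ v) \<in> fp_rel A B"
  | mult_r: "u \<in> fp_words A B \<Longrightarrow> v \<in> fp_words A B \<Longrightarrow> x \<in> carrier B \<Longrightarrow> y \<in> carrier B
      \<Longrightarrow> (u @ [Inr x, Inr y] @ v, u @ [Inr (x \<otimes>\<^bsub>B\<^esub> y)] @ v) \<in> fp_rel A B"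

definition free_product ::
    "('a, 'm) monoid_scheme \<Rightarrow> ('b, 'n) monoid_scheme \<Rightarrow> ('a + 'b) list set monoid"
  where "free_product A B =
    \<lparr>carrier = fp_words A B // fp_rel A B,
     monoid.mult = (\<lambda>P Q. \<Union>u\<in>P. \<Union>v\<in>Q. fp_rel A B `` {u @ v}),
     one = fp_rel A B `` {[]}\<rparr>"

definition fp_inl ::
    "('a, 'm) monoid_scheme \<Rightarrow> ('b, 'n) monoid_scheme \<Rightarrow> 'a \<Rightarrow> ('a + 'b) list set"
  where "fp_inl A B a = fp_rel A B `` {[Inl a]}"

definition fp_inr ::
    "('a, 'm) monoid_scheme \<Rightarrow> ('b, 'n) monoid_scheme \<Rightarrow> 'b \<Rightarrow> ('a + 'b) list set"
  where "fp_inr A B b = fp_rel A B `` {[Inr b]}"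

definition normal_closure :: "('a, 'm) monoid_scheme \<Rightarrow> 'a set \<Rightarrow> 'a set"
  where "normal_closure G S = \<Inter>{N. N \<lhd> G \<and> S \<subseteq> N}"

text \<open>The amalgamated subgroup of \<open>B\<close> is the image \<open>\<phi> ` C\<close>.\<close>

definition amalgamated_product ::
    "('a, 'm) monoid_scheme \<Rightarrow> ('b, 'n) monoid_scheme \<Rightarrow> 'a set \<Rightarrow> ('a \<Rightarrow> 'b)
      \<Rightarrow> ('a + 'b) list set set monoid"
  where "amalgamated_product A B C \<phi> =
    free_product A B Mod
      normal_closure (free_product A B)
        {fp_inl A B c \<otimes>\<^bsub>free_product A B\<^esub> inv\<^bsub>free_product A B\<^esub> (fp_inr A B (\<phi> c)) | c. c \<in> C}"

definition finitely_generated :: "('a, 'm) monoid_scheme \<Rightarrow> bool"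
  where "finitely_generated G \<longleftrightarrow>
    (\<exists>S. finite S \<and> S \<subseteq> carrier G \<and> generate G S = carrier G)"

definition torsion_free :: "('a, 'm) monoid_scheme \<Rightarrow> bool"
  where "torsion_free G \<longleftrightarrow>
    (\<forall>x\<in>carrier G. \<forall>n::nat. n > 0 \<longrightarrow> x [^]\<^bsub>G\<^esub> n = \<one>\<^bsub>G\<^esub> \<longrightarrow> x = \<one>\<^bsub>G\<^esub>)"

primrec lower_central_series :: "('a, 'm) monoid_scheme \<Rightarrow> nat \<Rightarrow> 'a set"
  where
    "lower_central_series G 0 = carrier G"
  | "lower_central_series G (Suc n) =
      generate G (\<Union>x\<in>lower_central_series G n. \<Union>y\<in>carrier G.
        {x \<otimes>\<^bsub>G\<^esub> y \<otimes>\<^bsub>G\<^esub> inv\<^bsub>G\<^esub> x \<otimes>\<^bsub>G\<^esub> inv\<^bsub>G\<^esub> y})"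

definition nilpotent :: "('a, 'm) monoid_scheme \<Rightarrow> bool"
  where "nilpotent G \<longleftrightarrow> (\<exists>n. lower_central_series G n = {\<one>\<^bsub>G\<^esub>})"

text \<open>
  The target group ranges over groups on the type of sets of elements of \<open>G\<close>. This is no
  restriction, since every homomorphic image of \<open>G\<close> is isomorphic to a quotient \<open>G Mod N\<close>,
  which lives on that type.
\<close>

definition residually_solvable :: "('a, 'm) monoid_scheme \<Rightarrow> bool"
  where "residually_solvable G \<longleftrightarrow>
    (\<forall>g\<in>carrier G. g \<noteq> \<one>\<^bsub>G\<^esub> \<longrightarrow>
      (\<exists>(S :: 'a set monoid) f. group S \<and> solvable S \<and> f \<in> epi G S \<and> f g \<noteq> \<one>\<^bsub>S\<^esub>))"

definition residually_solvable_by_abelian_by_finite_abelian :: "('a, 'm) monoid_scheme \<Rightarrow> bool"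
  where "residually_solvable_by_abelian_by_finite_abelian G \<longleftrightarrow>
    (\<exists>K D. K \<lhd> G \<and> comm_group (G Mod K) \<and> finite (carrier (G Mod K)) \<and>
       D \<lhd> G\<lparr>carrier := K\<rparr> \<and> comm_group (G\<lparr>carrier := K\<rparr> Mod D) \<and>
       residually_solvable (G\<lparr>carrier := D\<rparr>))"

lemma fp_words_simps [simp]:
  "[] \<in> fp_words A B"
  "u @ v \<in> fp_words A B \<longleftrightarrow> u \<in> fp_words A B \<and> v \<in> fp_words A B"
  "Inl a # u \<in> fp_words A B \<longleftrightarrow> a \<in> carrier A \<and> u \<in> fp_words A B"
  "Inr b # u \<in> fp_words A B \<longleftrightarrow> b \<in> carrier B \<and> u \<in> fp_words A B"
  by (auto simp: fp_words_def)

lemma fp_rel_in_words: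
  assumes "group A" "group B" "(u, v) \<in> fp_rel A B"
  shows "u \<in> fp_words A B \<and> v \<in> fp_words A B"
proof -
  interpret A: group A by fact
  interpret B: group B by fact
  show ?thesis using assms(3) by induction auto
qed

lemma equiv_fp_rel:
  assumes "group A" "group B"
  shows "equiv (fp_words A B) (fp_rel A B)"
  using fp_rel_in_words[OF assms]
  by (intro equivI)
     (auto simp: refl_on_def intro: fp_rel.refl intro!: symI transI
       dest: fp_rel.sym fp_rel.trans)

lemma fp_rel_context:
  assumes "(u, v) \<in> fp_rel A B" "p \<in> fp_words A B" "q \<in> fp_words A B"
  shows "(p @ u @ q, p @ v @ q) \<in> fp_rel A B"
  using assms(1)
proof induction
  case (one_l u v)
  then show ?case using fp_rel.one_l[of "p @ u" A B "v @ q"] assms by simp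
next
  case (one_r u v)
  then show ?case using fp_rel.one_r[of "p @ u" A B "v @ q"] assms by simp
next
  case (mult_l u v x y)
  then show ?case using fp_rel.mult_l[of "p @ u" A B "v @ q" x y] assms by simp
next
  case (mult_r u v x y)
  then show ?case using fp_rel.mult_r[of "p @ u" A B "v @ q" x y] assms by simp
qed (use assms in \<open>auto intro: fp_rel.refl fp_rel.sym fp_rel.trans\<close>)

lemma fp_rel_append:
  assumes "group A" "group B" "(u, u') \<in> fp_rel A B" "(v, v') \<in> fp_rel A B"
  shows "(u @ v, u' @ v') \<in> fp_rel A B"
proof -
  note W = fp_rel_in_words[OF assms(1,2)]
  have "(u @ v, u' @ v) \<in> fp_rel A B"
    using fp_rel_context[OF assms(3), of "[]" v] W[OF assms(4)] by simp
  moreover have "(u' @ v, u' @ v') \<in> fp_rel A B"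
    using fp_rel_context[OF assms(4), of u' "[]"] W[OF assms(3)] by simp
  ultimately show ?thesis by (rule fp_rel.trans)
qed

lemma free_product_mult:
  assumes "group A" "group B" "u \<in> fp_words A B" "v \<in> fp_words A B"
  shows "fp_rel A B `` {u} \<otimes>\<^bsub>free_product A B\<^esub> fp_rel A B `` {v} = fp_rel A B `` {u @ v}"
proof -
  have "congruent2 (fp_rel A B) (fp_rel A B) (\<lambda>u v. fp_rel A B `` {u @ v})"
    using fp_rel_append[OF assms(1,2)]
    by (intro congruent2I') (rule equiv_class_eq[OF equiv_fp_rel[OF assms(1,2)]], blast)
  then show ?thesis
    using UN_equiv_class2[OF equiv_fp_rel[OF assms(1,2)] equiv_fp_rel[OF assms(1,2)] _ assms(3,4)]
    by (simp add: free_product_def)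
qed

lemma free_product_inverse:
  assumes "group A" "group B" "w \<in> fp_words A B"
  shows "\<exists>w'\<in>fp_words A B. (w' @ w, []) \<in> fp_rel A B"
  using assms(3)
proof (induction w)
  case Nil
  then show ?case by (intro bexI[of _ "[]"]) (auto intro: fp_rel.refl)
next
  case (Cons z w)
  interpret A: group A by fact
  interpret B: group B by fact
  have w: "w \<in> fp_words A B" using Cons.prems by (simp add: fp_words_def)
  then obtain w' where w': "w' \<in> fp_words A B" "(w' @ w, []) \<in> fp_rel A B"
    using Cons.IH by blast
  show ?case
  proof (cases z)
    case (Inl a)
    then have a: "a \<in> carrier A" using Cons.prems by simp
    have "(w' @ [Inl (inv\<^bsub>A\<^esub> a), Inl a] @ w, w' @ [Inl \<one>\<^bsub>A\<^esub>] @ w) \<in> fp_rel A B"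
      using fp_rel.mult_l[OF w'(1) w, of "inv\<^bsub>A\<^esub> a" a] a by simp
    from fp_rel.trans[OF fp_rel.trans[OF this fp_rel.one_l[OF w'(1) w]] w'(2)]
    show ?thesis using a w'(1) Inl by (intro bexI[of _ "w' @ [Inl (inv\<^bsub>A\<^esub> a)]"]) auto
  next
    case (Inr b)
    then have b: "b \<in> carrier B" using Cons.prems by simp
    have "(w' @ [Inr (inv\<^bsub>B\<^esub> b), Inr b] @ w, w' @ [Inr \<one>\<^bsub>B\<^esub>] @ w) \<in> fp_rel A B"
      using fp_rel.mult_r[OF w'(1) w, of "inv\<^bsub>B\<^esub> b" b] b by simp
    from fp_rel.trans[OF fp_rel.trans[OF this fp_rel.one_r[OF w'(1) w]] w'(2)]
    show ?thesis using b w'(1) Inr by (intro bexI[of _ "w' @ [Inr (inv\<^bsub>B\<^esub> b)]"]) auto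
  qed
qed

lemma group_free_product:
  assumes "group A" "group B"
  shows "group (free_product A B)"
proof -
  let ?F = "free_product A B" and ?W = "fp_words A B" and ?cl = "\<lambda>u. fp_rel A B `` {u}"
  have car: "P \<in> carrier ?F \<longleftrightarrow> (\<exists>u\<in>?W. P = ?cl u)" for P
    by (auto simp: free_product_def quotient_def)
  have one: "\<one>\<^bsub>?F\<^esub> = ?cl []" by (simp add: free_product_def)
  note mult = free_product_mult[OF assms]
  show ?thesis
  proof (rule groupI)
    fix P Q assume "P \<in> carrier ?F" "Q \<in> carrier ?F"
    then show "P \<otimes>\<^bsub>?F\<^esub> Q \<in> carrier ?F" by (auto simp: car mult intro!: bexI[of _ "_ @ _"])
  next
    fix P Q R assume "P \<in> carrier ?F" "Q \<in> carrier ?F" "R \<in> carrier ?F"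
    then show "P \<otimes>\<^bsub>?F\<^esub> Q \<otimes>\<^bsub>?F\<^esub> R = P \<otimes>\<^bsub>?F\<^esub> (Q \<otimes>\<^bsub>?F\<^esub> R)"
      by (auto simp: car mult)
  next
    fix P assume "P \<in> carrier ?F"
    then obtain u where u: "u \<in> ?W" "P = ?cl u" by (auto simp: car)
    obtain v where v: "v \<in> ?W" "(v @ u, []) \<in> fp_rel A B"
      using free_product_inverse[OF assms u(1)] by blast
    then have "?cl v \<otimes>\<^bsub>?F\<^esub> P = \<one>\<^bsub>?F\<^esub>"
      using u by (simp add: mult one equiv_class_eq[OF equiv_fp_rel[OF assms]])
    then show "\<exists>Q\<in>carrier ?F. Q \<otimes>\<^bsub>?F\<^esub> P = \<one>\<^bsub>?F\<^esub>"
      using v(1) car by blast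
  qed (auto simp: car one mult intro: bexI[of _ "[]"])
qed

lemma fp_inl_hom:
  assumes "group A" "group B"
  shows "fp_inl A B \<in> hom A (free_product A B)"
proof -
  interpret A: group A by fact
  show ?thesis
    using fp_rel.mult_l[of "[]" A B "[]"]
    by (intro homI)
       (auto simp: fp_inl_def free_product_mult[OF assms] free_product_def[THEN arg_cong, of carrier]
         intro!: quotientI equiv_class_eq[OF equiv_fp_rel[OF assms], symmetric])
qed

lemma fp_inr_hom:
  assumes "group A" "group B"
  shows "fp_inr A B \<in> hom B (free_product A B)"
proof -
  interpret B: group B by fact
  show ?thesis
    using fp_rel.mult_r[of "[]" A B "[]"]
    by (intro homI)
       (auto simp: fp_inr_def free_product_mult[OF assms] free_product_def[THEN arg_cong, of carrier]
         intro!: quotientI equiv_class_eq[OF equiv_fp_rel[OF assms], symmetric])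
qed

lemma normal_closure_normal:
  assumes "group G" "S \<subseteq> carrier G"
  shows "normal_closure G S \<lhd> G"
proof -
  interpret group G by fact
  have "carrier G \<lhd> G"
    by (auto simp: normal_inv_iff subgroup_self)
  then have ne: "{N. N \<lhd> G \<and> S \<subseteq> N} \<noteq> {}" using assms(2) by blast
  have "subgroup (\<Inter>{N. N \<lhd> G \<and> S \<subseteq> N}) G"
    using ne by (intro subgroups_Inter) (auto dest: normal_imp_subgroup)
  then show ?thesis
    unfolding normal_closure_def normal_inv_iff
    by (auto simp: normal_inv_iff)
qed

lemma group_amalgamated_product:
  assumes "group A" "group B" "C \<subseteq> carrier A" "\<phi> ` C \<subseteq> carrier B"
  shows "group (amalgamated_product A B C \<phi>)"
proof -
  interpret F: group "free_product A B" by (rule group_free_product[OF assms(1,2)])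
  have "fp_inl A B c \<otimes>\<^bsub>free_product A B\<^esub> inv\<^bsub>free_product A B\<^esub> (fp_inr A B (\<phi> c))
      \<in> carrier (free_product A B)" if "c \<in> C" for c
    using that assms(3,4) fp_inl_hom[OF assms(1,2)] fp_inr_hom[OF assms(1,2)]
    by (intro F.m_closed F.inv_closed) (auto simp: hom_def)
  then show ?thesis
    unfolding amalgamated_product_def
    by (intro normal.factorgroup_is_group normal_closure_normal F.group_axioms) auto
qed

end

theory Submission
  imports Defs
begin

text \<open>
  Write \<open>G\<close> for the amalgamated product and \<open>G\<^sub>n\<close> for the terms of its derived series. It
  suffices to show that the intersection of all \<open>G\<^sub>n\<close> is trivial, because residual solvability
  passes to the subgroup \<open>G\<^sub>1\<close>, and \<open>G\<close> modulo \<open>G\<^sub>1\<close> is abelian.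

  First, \<open>G\<close> maps to the solvable group \<open>B\<close> wr \<open>(A Mod C)\<close> injectively on \<open>A\<close> and on \<open>B\<close>, so
  some \<open>N = G\<^sub>n\<close> meets both factors trivially; hence no reduced word of length 1 lies in \<open>N C\<close>.
  Second, if no nonempty reduced word of length at most \<open>L\<close> lies in \<open>N C\<close>, the same holds with
  \<open>L + 1\<close> for the derived subgroup \<open>N'\<close>. In terms of the quotient of the Bass--Serre tree
  by \<open>N\<close>, a reduced word of length \<open>L + 1\<close> in \<open>N\<close> is a closed path without repeated edges,
  so it is homologically nontrivial, and \<open>N'\<close> consists of homologically trivial paths. The class
  in homology is computed by a homomorphism from \<open>G\<close> to the wreath product of the integers by
  \<open>G Mod N\<close>.
\<close>

section \<open>Wreath products\<close>

text \<open>The unrestricted wreath product, with \<open>Q\<close> acting on functions by left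
  translation. Functions are extensional, so that equality of elements is equality on
  \<open>carrier Q\<close>.\<close>

definition wreath_product ::
    "('h, 'm) monoid_scheme \<Rightarrow> ('q, 'n) monoid_scheme \<Rightarrow> (('q \<Rightarrow> 'h) \<times> 'q) monoid"
  where "wreath_product H Q =
    \<lparr>carrier = (carrier Q \<rightarrow>\<^sub>E carrier H) \<times> carrier Q,
     monoid.mult = (\<lambda>(h, x) (k, y).
       (\<lambda>z\<in>carrier Q. h z \<otimes>\<^bsub>H\<^esub> k (inv\<^bsub>Q\<^esub> x \<otimes>\<^bsub>Q\<^esub> z), x \<otimes>\<^bsub>Q\<^esub> y)),
     one = (\<lambda>z\<in>carrier Q. \<one>\<^bsub>H\<^esub>, \<one>\<^bsub>Q\<^esub>)\<rparr>"

lemma wreath_product_simps: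
  "carrier (wreath_product H Q) = (carrier Q \<rightarrow>\<^sub>E carrier H) \<times> carrier Q"
  "(h, x) \<otimes>\<^bsub>wreath_product H Q\<^esub> (k, y) =
    (\<lambda>z\<in>carrier Q. h z \<otimes>\<^bsub>H\<^esub> k (inv\<^bsub>Q\<^esub> x \<otimes>\<^bsub>Q\<^esub> z), x \<otimes>\<^bsub>Q\<^esub> y)"
  "\<one>\<^bsub>wreath_product H Q\<^esub> = (\<lambda>z\<in>carrier Q. \<one>\<^bsub>H\<^esub>, \<one>\<^bsub>Q\<^esub>)"
  by (simp_all add: wreath_product_def)

lemma wreath_product_mult:
  "fst (u \<otimes>\<^bsub>wreath_product H Q\<^esub> v) =
    (\<lambda>z\<in>carrier Q. fst u z \<otimes>\<^bsub>H\<^esub> fst v (inv\<^bsub>Q\<^esub> (snd u) \<otimes>\<^bsub>Q\<^esub> z))"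
  "snd (u \<otimes>\<^bsub>wreath_product H Q\<^esub> v) = snd u \<otimes>\<^bsub>Q\<^esub> snd v"
  by (simp_all add: wreath_product_def case_prod_beta)

lemma group_wreath_product:
  assumes "group H" "group Q"
  shows "group (wreath_product H Q)"
proof -
  interpret H: group H by fact
  interpret Q: group Q by fact
  show ?thesis
  proof (rule groupI)
    fix u v assume "u \<in> carrier (wreath_product H Q)" "v \<in> carrier (wreath_product H Q)"
    then show "u \<otimes>\<^bsub>wreath_product H Q\<^esub> v \<in> carrier (wreath_product H Q)"
      by (cases u; cases v) (auto simp: wreath_product_simps)
  next
    fix u v w assume "u \<in> carrier (wreath_product H Q)" "v \<in> carrier (wreath_product H Q)"
      "w \<in> carrier (wreath_product H Q)"
    then show "u \<otimes>\<^bsub>wreath_product H Q\<^esub> v \<otimes>\<^bsub>wreath_product H Q\<^esub> w =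
        u \<otimes>\<^bsub>wreath_product H Q\<^esub> (v \<otimes>\<^bsub>wreath_product H Q\<^esub> w)"
      by (cases u; cases v; cases w)
         (auto simp: wreath_product_simps fun_eq_iff Q.m_assoc Q.inv_mult_group PiE_mem
           intro!: H.m_assoc)
  next
    fix u assume "u \<in> carrier (wreath_product H Q)"
    then obtain h x where u: "u = (h, x)" and h: "h \<in> carrier Q \<rightarrow>\<^sub>E carrier H"
      and x: "x \<in> carrier Q"
      by (auto simp: wreath_product_simps)
    show "\<one>\<^bsub>wreath_product H Q\<^esub> \<otimes>\<^bsub>wreath_product H Q\<^esub> u = u"
    proof -
      have "(\<lambda>z\<in>carrier Q. \<one>\<^bsub>H\<^esub> \<otimes>\<^bsub>H\<^esub> (h (inv\<^bsub>Q\<^esub> \<one>\<^bsub>Q\<^esub> \<otimes>\<^bsub>Q\<^esub> z))) = restrict h (carrier Q)"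
        using PiE_mem[OF h] by (intro restrict_ext) simp
      then show ?thesis
        using h x by (simp add: u wreath_product_simps PiE_restrict cong: restrict_cong)
    qed
    show "\<exists>v\<in>carrier (wreath_product H Q). v \<otimes>\<^bsub>wreath_product H Q\<^esub> u = \<one>\<^bsub>wreath_product H Q\<^esub>"
      using h x PiE_mem[OF h]
      by (intro bexI[of _ "(\<lambda>z\<in>carrier Q. inv\<^bsub>H\<^esub> h (x \<otimes>\<^bsub>Q\<^esub> z), inv\<^bsub>Q\<^esub> x)"])
         (auto simp: u wreath_product_simps fun_eq_iff restrict_def)
  qed (auto simp: wreath_product_simps)
qed

text \<open>Evaluation at a point is a homomorphism only on the base group.\<close>

lemma wreath_product_eval_hom:
  assumes "group H" "group Q" "F \<in> hom G (wreath_product H Q)" "N \<subseteq> carrier G"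
    and base: "\<And>g. g \<in> N \<Longrightarrow> snd (F g) = \<one>\<^bsub>Q\<^esub>" and z: "z \<in> carrier Q"
  shows "(\<lambda>g. fst (F g) z) \<in> hom (G\<lparr>carrier := N\<rparr>) H"
proof -
  interpret H: group H by fact
  interpret Q: group Q by fact
  have F: "F g \<in> carrier (wreath_product H Q)" if "g \<in> N" for g
    using that assms(3,4) by (auto simp: hom_def)
  have mult: "F (g \<otimes>\<^bsub>G\<^esub> h) = F g \<otimes>\<^bsub>wreath_product H Q\<^esub> F h" if "g \<in> N" "h \<in> N" for g h
    using that assms(3,4) by (auto simp: hom_def)
  show ?thesis
  proof (rule homI)
    fix g assume "g \<in> carrier (G\<lparr>carrier := N\<rparr>)"
    then show "fst (F g) z \<in> carrier H"
      using F[of g] z by (auto simp: wreath_product_simps PiE_mem)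
  next
    fix g h assume gh: "g \<in> carrier (G\<lparr>carrier := N\<rparr>)" "h \<in> carrier (G\<lparr>carrier := N\<rparr>)"
    then show "fst (F (g \<otimes>\<^bsub>G\<lparr>carrier := N\<rparr>\<^esub> h)) z = fst (F g) z \<otimes>\<^bsub>H\<^esub> fst (F h) z"
      using z by (simp add: mult wreath_product_mult base)
  qed
qed

text \<open>Homomorphisms carry derived subgroups to derived subgroups; on \<open>N\<close>,
  evaluation at \<open>z\<close> is such a homomorphism.\<close>

lemma wreath_product_derived:
  assumes "group G" "group H" "group Q" "F \<in> hom G (wreath_product H Q)" "subgroup N G"
    and "\<And>g. g \<in> N \<Longrightarrow> snd (F g) = \<one>\<^bsub>Q\<^esub>" "z \<in> carrier Q" "K \<subseteq> N" "g \<in> derived G K"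
    and "L \<subseteq> carrier H" "\<And>g. g \<in> K \<Longrightarrow> fst (F g) z \<in> L"
  shows "fst (F g) z \<in> derived H L"
proof -
  interpret G: group G by fact
  interpret H: group H by fact
  interpret E: group_hom "G\<lparr>carrier := N\<rparr>" H "\<lambda>g. fst (F g) z"
    using assms G.subgroup_imp_group subgroup.subset[OF assms(5)]
    by (simp add: group_hom_def group_hom_axioms_def wreath_product_eval_hom)
  have "fst (F g) z \<in> (\<lambda>g. fst (F g) z) ` derived G K" using assms by blast
  also have "\<dots> = derived H ((\<lambda>g. fst (F g) z) ` K)"
    using E.derived_img[of K] G.derived_consistent[OF assms(8,5)] assms(8) by simp
  also have "\<dots> \<subseteq> derived H L" using assms(11) by (intro H.mono_derived) auto
  finally show ?thesis .
qed

section \<open>Universal property of free products\<close>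

text \<open>A word is sent to the product of the images of its letters; every generating relation of
  \<open>fp_rel\<close> preserves this product.\<close>

lemma free_product_universal:
  assumes "group A" "group B" "group H" "\<alpha> \<in> hom A H" "\<beta> \<in> hom B H"
  obtains F where "F \<in> hom (free_product A B) H"
    "\<And>a. a \<in> carrier A \<Longrightarrow> F (fp_inl A B a) = \<alpha> a"
    "\<And>b. b \<in> carrier B \<Longrightarrow> F (fp_inr A B b) = \<beta> b"
proof -
  interpret H: group H by fact
  interpret \<alpha>: group_hom A H \<alpha> using assms by (simp add: group_hom_def group_hom_axioms_def)
  interpret \<beta>: group_hom B H \<beta> using assms by (simp add: group_hom_def group_hom_axioms_def)
  define ev where "ev w = foldr (\<lambda>l r. case_sum \<alpha> \<beta> l \<otimes>\<^bsub>H\<^esub> r) w \<one>\<^bsub>H\<^esub>" for w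
  have ev_simps [simp]: "ev [] = \<one>\<^bsub>H\<^esub>" "ev (l # w) = case_sum \<alpha> \<beta> l \<otimes>\<^bsub>H\<^esub> ev w" for l w
    by (simp_all add: ev_def)
  have letter: "case_sum \<alpha> \<beta> l \<in> carrier H" if "l \<in> carrier A <+> carrier B" for l
    using that by auto
  have closed [simp]: "ev w \<in> carrier H" if "w \<in> fp_words A B" for w
    using that by (induction w) (auto simp: fp_words_def letter)
  have append: "ev (u @ v) = ev u \<otimes>\<^bsub>H\<^esub> ev v" if "u \<in> fp_words A B" "v \<in> fp_words A B" for u v
    using that(1)
  proof (induction u)
    case Nil
    then show ?case using that by simp
  next
    case (Cons l u)
    then have "l \<in> carrier A <+> carrier B" "u \<in> fp_words A B" by (auto simp: fp_words_def)
    with Cons.IH that show ?case by (simp add: H.m_assoc letter)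
  qed
  have ev_eq: "ev u = ev v" if "(u, v) \<in> fp_rel A B" for u v
    using that by induction (simp_all add: append H.m_assoc)
  define F where "F P = ev (SOME w. w \<in> P)" for P
  have F: "F (fp_rel A B `` {w}) = ev w" if "w \<in> fp_words A B" for w
  proof -
    have "w \<in> fp_rel A B `` {w}" using that by (auto intro: fp_rel.refl)
    then have "(SOME w'. w' \<in> fp_rel A B `` {w}) \<in> fp_rel A B `` {w}" by (rule someI)
    then show ?thesis using ev_eq by (auto simp: F_def)
  qed
  have "F \<in> hom (free_product A B) H"
  proof (rule homI)
    fix P Q assume "P \<in> carrier (free_product A B)" "Q \<in> carrier (free_product A B)"
    then obtain u v where "u \<in> fp_words A B" "v \<in> fp_words A B"
      "P = fp_rel A B `` {u}" "Q = fp_rel A B `` {v}"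
      by (auto simp: free_product_def quotient_def)
    then show "F (P \<otimes>\<^bsub>free_product A B\<^esub> Q) = F P \<otimes>\<^bsub>H\<^esub> F Q"
      by (simp add: free_product_mult[OF assms(1,2)] F append)
  qed (auto simp: free_product_def quotient_def F)
  then show ?thesis
    by (rule that) (simp_all add: fp_inl_def fp_inr_def F)
qed

section \<open>Derived series and residual solvability\<close>

lemma lower_central_series_subset:
  assumes "group G"
  shows "lower_central_series G n \<subseteq> carrier G"
proof -
  interpret group G by fact
  show ?thesis
  proof (induction n)
    case (Suc n)
    then show ?case unfolding lower_central_series.simps
      by (intro generate_incl) auto
  qed simp
qed

text \<open>The derived series lies termwise inside the lower central series.\<close>

lemma nilpotent_imp_derived_trivial:
  assumes "group G" "nilpotent G"
  obtains n where "(derived G ^^ n) (carrier G) = {\<one>\<^bsub>G\<^esub>}"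
proof -
  interpret group G by fact
  have le: "(derived G ^^ n) (carrier G) \<subseteq> lower_central_series G n" for n
  proof (induction n)
    case (Suc n)
    have "(derived G ^^ n) (carrier G) \<subseteq> carrier G" by (rule exp_of_derived_in_carrier) simp
    with Suc show ?case
      unfolding lower_central_series.simps funpow.simps o_def derived_def[of G "(derived G ^^ n) (carrier G)"]
      by (intro mono_generate) blast
  qed simp
  from assms(2) obtain n where "lower_central_series G n = {\<one>\<^bsub>G\<^esub>}" by (auto simp: nilpotent_def)
  with le[of n] have "(derived G ^^ n) (carrier G) \<subseteq> {\<one>\<^bsub>G\<^esub>}" by simp
  moreover have "\<one>\<^bsub>G\<^esub> \<in> (derived G ^^ n) (carrier G)"
    by (intro subgroup.one_closed exp_of_derived_is_subgroup subgroup_self)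
  ultimately show ?thesis by (intro that) blast
qed

lemma (in group) exp_of_derived_is_normal: "(derived G ^^ n) (carrier G) \<lhd> G"
  by (induction n) (simp_all add: normal_self derived_is_normal)

text \<open>The quotient by a term of the derived series that misses \<open>g\<close> is solvable
  and keeps \<open>g\<close> nontrivial. Its elements are cosets, so it has the type that
  \<open>residually_solvable\<close> asks for.\<close>

lemma (in group) residually_solvable_if_derived:
  assumes "\<And>g. g \<in> carrier G \<Longrightarrow> g \<noteq> \<one> \<Longrightarrow> \<exists>n. g \<notin> (derived G ^^ n) (carrier G)"
  shows "residually_solvable G"
  unfolding residually_solvable_def
proof (intro ballI impI)
  fix g assume g: "g \<in> carrier G" "g \<noteq> \<one>"
  then obtain n where n: "g \<notin> (derived G ^^ n) (carrier G)" using assms by blast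
  define N where "N = (derived G ^^ n) (carrier G)"
  interpret N: normal N G unfolding N_def by (rule exp_of_derived_is_normal)
  interpret Q: group "G Mod N" by (rule N.factorgroup_is_group)
  interpret q: group_hom G "G Mod N" "\<lambda>x. N #> x"
    by (simp add: group_hom_def group_hom_axioms_def N.r_coset_hom_Mod)
  have surj: "(\<lambda>x. N #> x) ` carrier G = carrier (G Mod N)"
    by (simp add: carrier_FactGroup)
  have "(derived (G Mod N) ^^ n) (carrier (G Mod N)) = (\<lambda>x. N #> x) ` N"
    using q.exp_of_derived_img[of "carrier G" n] surj by (simp add: N_def)
  also have "\<dots> = (\<lambda>x. N) ` N"
    using N.rcos_const[OF is_group] by (intro image_cong) auto
  also have "\<dots> = {\<one>\<^bsub>G Mod N\<^esub>}"
    using image_constant[OF subgroup.one_closed[OF N.subgroup_axioms]] by simp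
  finally have "solvable (G Mod N)"
    unfolding solvable_def by (rule Q.trivial_derived_seq_imp_solvable[OF Q.subgroup_self])
  moreover have "N #> g \<noteq> \<one>\<^bsub>G Mod N\<^esub>"
    using n rcos_self[OF g(1) N.subgroup_axioms] by (auto simp flip: N_def)
  ultimately show "\<exists>(S :: 'a set monoid) f. group S \<and> solvable S \<and> f \<in> epi G S \<and> f g \<noteq> \<one>\<^bsub>S\<^esub>"
    using surj Q.group_axioms q.homh
    by (intro exI[of _ "G Mod N"] exI[of _ "\<lambda>x. N #> x"]) (auto simp: epi_def)
qed

text \<open>The derived series of a subgroup lies termwise inside that of the whole group.\<close>

lemma (in group) residually_solvable_subgroup:
  assumes "\<And>g. g \<in> carrier G \<Longrightarrow> g \<noteq> \<one> \<Longrightarrow> \<exists>n. g \<notin> (derived G ^^ n) (carrier G)"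
    and "subgroup D G"
  shows "residually_solvable (G\<lparr>carrier := D\<rparr>)"
proof -
  interpret D: group "G\<lparr>carrier := D\<rparr>" by (rule subgroup_imp_group[OF assms(2)])
  have sub: "(derived (G\<lparr>carrier := D\<rparr>) ^^ n) D \<subseteq> (derived G ^^ n) (carrier G)" for n
  proof (induction n)
    case 0
    then show ?case using subgroup.subset[OF assms(2)] by simp
  next
    case (Suc n)
    have "(derived (G\<lparr>carrier := D\<rparr>) ^^ n) D \<subseteq> D"
      using D.exp_of_derived_in_carrier[of D n] by simp
    with mono_derived[OF Suc] derived_consistent[OF _ assms(2)] show ?case by simp
  qed
  show ?thesis
  proof (rule D.residually_solvable_if_derived)
    fix g assume "g \<in> carrier (G\<lparr>carrier := D\<rparr>)" "g \<noteq> \<one>\<^bsub>G\<lparr>carrier := D\<rparr>\<^esub>"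
    then have "g \<in> carrier G" "g \<noteq> \<one>" using subgroup.subset[OF assms(2)] by auto
    from assms(1)[OF this] sub
    show "\<exists>n. g \<notin> (derived (G\<lparr>carrier := D\<rparr>) ^^ n) (carrier (G\<lparr>carrier := D\<rparr>))" by auto
  qed
qed

text \<open>Take \<open>K\<close> to be the whole group and \<open>D\<close> its derived subgroup;
  the finite abelian quotient is then trivial.\<close>

lemma (in group) residually_solvable_by_abelian_by_finite_abelianI:
  assumes "residually_solvable (G\<lparr>carrier := derived G (carrier G)\<rparr>)"
  shows "residually_solvable_by_abelian_by_finite_abelian G"
proof -
  have "carrier (G Mod carrier G) = {carrier G}"
    using coset_join2[OF _ subgroup_self] by (auto simp: carrier_FactGroup)
  then have "finite (carrier (G Mod carrier G))" "comm_group (G Mod carrier G)"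
    using normal.factorgroup_is_group[OF normal_self]
    by (auto intro!: group.group_comm_groupI)
  moreover have "derived G (carrier G) \<lhd> G\<lparr>carrier := carrier G\<rparr>"
    by (simp add: derived_self_is_normal)
  ultimately show ?thesis
    unfolding residually_solvable_by_abelian_by_finite_abelian_def
    using assms normal_self derived_quot_is_comm_group
    by (intro exI[of _ "carrier G"] exI[of _ "derived G (carrier G)"]) auto
qed

section \<open>Amalgamated products\<close>

locale amalgam =
  fixes A :: "('a, 'm) monoid_scheme" (structure) and B :: "('b, 'n) monoid_scheme"
    and C :: "'a set" and D :: "'b set" and \<phi> :: "'a \<Rightarrow> 'b"
  assumes group_A: "group A" and group_B: "group B"
    and subgroup_C: "subgroup C A" and subgroup_D: "subgroup D B"
    and \<phi>_iso: "\<phi> \<in> iso (A\<lparr>carrier := C\<rparr>) (B\<lparr>carrier := D\<rparr>)"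
begin

abbreviation G where "G \<equiv> amalgamated_product A B C \<phi>"

abbreviation "relators \<equiv>
  {fp_inl A B c \<otimes>\<^bsub>free_product A B\<^esub> inv\<^bsub>free_product A B\<^esub> (fp_inr A B (\<phi> c)) | c. c \<in> C}"

definition "rel_closure = normal_closure (free_product A B) relators"

definition "inl a = rel_closure #>\<^bsub>free_product A B\<^esub> fp_inl A B a"
definition "inr b = rel_closure #>\<^bsub>free_product A B\<^esub> fp_inr A B b"

text \<open>The two factors are indexed by \<open>bool\<close>, so that alternation of letters is negation.\<close>

definition "side t = (if t then inl ` carrier A else inr ` carrier B)"
definition "amalg = inl ` C"

sublocale A: group A by (rule group_A)
sublocale B: group B by (rule group_B)
sublocale FP: group "free_product A B" by (rule group_free_product[OF group_A group_B])
sublocale l: group_hom A "free_product A B" "fp_inl A B"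
  by unfold_locales (rule fp_inl_hom[OF group_A group_B])
sublocale r: group_hom B "free_product A B" "fp_inr A B"
  by unfold_locales (rule fp_inr_hom[OF group_A group_B])

lemma C_closed [simp]: "c \<in> C \<Longrightarrow> c \<in> carrier A"
  using subgroup.subset[OF subgroup_C] by blast

lemma \<phi>_in_D: "c \<in> C \<Longrightarrow> \<phi> c \<in> D"
  using \<phi>_iso by (auto simp: iso_def hom_def)

lemma \<phi>_closed [simp]: "c \<in> C \<Longrightarrow> \<phi> c \<in> carrier B"
  using \<phi>_in_D subgroup.subset[OF subgroup_D] by blast

lemma \<phi>_mult: "c \<in> C \<Longrightarrow> d \<in> C \<Longrightarrow> \<phi> (c \<otimes> d) = \<phi> c \<otimes>\<^bsub>B\<^esub> \<phi> d"
  using \<phi>_iso by (auto simp: iso_def hom_def)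

lemma \<phi>_inj: "inj_on \<phi> C"
  using \<phi>_iso by (auto simp: iso_def bij_betw_def)

lemma relators_subset: "relators \<subseteq> carrier (free_product A B)"
  by auto

lemma rel_closure_normal: "rel_closure \<lhd> free_product A B"
  unfolding rel_closure_def
  by (rule normal_closure_normal[OF FP.group_axioms relators_subset])

lemma G_eq: "G = free_product A B Mod rel_closure"
  by (simp add: amalgamated_product_def rel_closure_def)

sublocale G: group G
  by (rule group_amalgamated_product[OF group_A group_B]) auto

lemma quotient_hom: "(\<lambda>x. rel_closure #>\<^bsub>free_product A B\<^esub> x) \<in> hom (free_product A B) G"
  unfolding G_eq by (rule normal.r_coset_hom_Mod[OF rel_closure_normal])

lemma inl_hom: "inl \<in> hom A G"
  using hom_compose[OF l.homh quotient_hom] by (simp add: inl_def[abs_def] o_def)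

lemma inr_hom: "inr \<in> hom B G"
  using hom_compose[OF r.homh quotient_hom] by (simp add: inr_def[abs_def] o_def)

sublocale inl: group_hom A G inl by unfold_locales (rule inl_hom)
sublocale inr: group_hom B G inr by unfold_locales (rule inr_hom)

lemma inl_eq_inr:
  assumes "c \<in> C"
  shows "inl c = inr (\<phi> c)"
proof -
  interpret N: normal rel_closure "free_product A B" by (rule rel_closure_normal)
  have "relators \<subseteq> rel_closure" by (auto simp: rel_closure_def normal_closure_def)
  then have "fp_inl A B c \<otimes>\<^bsub>free_product A B\<^esub> inv\<^bsub>free_product A B\<^esub> (fp_inr A B (\<phi> c)) \<in> rel_closure"
    using assms by blast
  then have "fp_inl A B c \<in> rel_closure #>\<^bsub>free_product A B\<^esub> fp_inr A B (\<phi> c)"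
    using assms by (intro N.rcos_module_rev) auto
  then have "rel_closure #>\<^bsub>free_product A B\<^esub> fp_inr A B (\<phi> c) =
      rel_closure #>\<^bsub>free_product A B\<^esub> fp_inl A B c"
    using assms by (intro FP.repr_independence N.subgroup_axioms) auto
  then show ?thesis by (simp add: inl_def inr_def)
qed

text \<open>Compatibility on \<open>C\<close> puts the relators into the kernel of the induced map
  on the free product. The kernel is normal, so it contains their normal closure and the map
  factors.\<close>

lemma universal:
  assumes "group H" "\<alpha> \<in> hom A H" "\<beta> \<in> hom B H" "\<And>c. c \<in> C \<Longrightarrow> \<alpha> c = \<beta> (\<phi> c)"
  obtains F where "F \<in> hom G H" "\<And>a. a \<in> carrier A \<Longrightarrow> F (inl a) = \<alpha> a"
    "\<And>b. b \<in> carrier B \<Longrightarrow> F (inr b) = \<beta> b"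
proof -
  interpret H: group H by fact
  obtain F where F: "F \<in> hom (free_product A B) H"
    "\<And>a. a \<in> carrier A \<Longrightarrow> F (fp_inl A B a) = \<alpha> a"
    "\<And>b. b \<in> carrier B \<Longrightarrow> F (fp_inr A B b) = \<beta> b"
    using free_product_universal[OF group_A group_B assms(1-3)] by blast
  interpret F: group_hom "free_product A B" H F by unfold_locales (rule F(1))
  have "\<alpha> c \<in> carrier H" if "c \<in> C" for c
    using assms(2) C_closed[OF that] by (auto simp: hom_def)
  then have "relators \<subseteq> kernel (free_product A B) H F"
    by (auto simp: kernel_def F(2,3) assms(4))
  then have "rel_closure \<subseteq> kernel (free_product A B) H F"
    unfolding rel_closure_def normal_closure_def using F.normal_kernel by blast
  from F.FactGroup_universal_kernel[OF rel_closure_normal this] obtain F' where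
    "F' \<in> hom (free_product A B Mod rel_closure) H"
    "\<And>x. x \<in> carrier (free_product A B) \<Longrightarrow> F' (rel_closure #>\<^bsub>free_product A B\<^esub> x) = F x"
    by blast
  then show ?thesis
    by (intro that[of F']) (simp_all add: G_eq inl_def inr_def F(2,3))
qed

lemma side_subgroup: "subgroup (side t) G"
  by (cases t) (simp_all add: side_def inl.img_is_subgroup inr.img_is_subgroup)

lemma side_closed [simp]: "x \<in> side t \<Longrightarrow> x \<in> carrier G"
  using subgroup.subset[OF side_subgroup] by blast

lemma amalg_subgroup: "subgroup amalg G"
  unfolding amalg_def by (rule inl.subgroup_img_is_subgroup[OF subgroup_C])

lemma amalg_subset_side: "amalg \<subseteq> side t"
  by (auto simp: amalg_def side_def) (simp add: inl_eq_inr)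

lemma amalg_closed [simp]: "x \<in> amalg \<Longrightarrow> x \<in> carrier G"
  using subgroup.subset[OF amalg_subgroup] by blast

section \<open>Reduced words and the existence of normal forms\<close>

text \<open>Letters are elements of \<open>G\<close>, and no coset representatives are fixed, so one
  element may be the product of several reduced words.\<close>

fun reduced where
  "reduced t [] \<longleftrightarrow> True"
| "reduced t (x # w) \<longleftrightarrow> x \<in> side t \<and> x \<notin> amalg \<and> reduced (\<not> t) w"

definition "word_prod w = foldr (\<otimes>\<^bsub>G\<^esub>) w \<one>\<^bsub>G\<^esub>"

lemma word_prod_simps [simp]:
  "word_prod [] = \<one>\<^bsub>G\<^esub>" "word_prod (x # w) = x \<otimes>\<^bsub>G\<^esub> word_prod w"
  by (simp_all add: word_prod_def)

lemma word_prod_closed [simp]: "reduced t w \<Longrightarrow> word_prod w \<in> carrier G"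
  by (induction w arbitrary: t) auto

lemma reduced_take: "reduced t w \<Longrightarrow> reduced t (take k w)"
  by (induction w arbitrary: t k) (auto simp: take_Cons split: nat.split)

lemma not_in_amalg_mult:
  assumes "c \<in> amalg" "x \<in> carrier G" "x \<notin> amalg"
  shows "c \<otimes>\<^bsub>G\<^esub> x \<notin> amalg"
proof
  assume "c \<otimes>\<^bsub>G\<^esub> x \<in> amalg"
  with assms(1) have "inv\<^bsub>G\<^esub> c \<otimes>\<^bsub>G\<^esub> (c \<otimes>\<^bsub>G\<^esub> x) \<in> amalg"
    using subgroup.m_closed[OF amalg_subgroup] subgroup.m_inv_closed[OF amalg_subgroup] by blast
  then show False using assms by (simp flip: G.m_assoc)
qed

text \<open>An amalgamated element lies in the images of both factors, so it merges into the first
  letter without changing the length or the alternation.\<close>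

lemma reduced_absorb:
  assumes "c \<in> amalg" "reduced t (x # w)"
  shows "reduced t (c \<otimes>\<^bsub>G\<^esub> x # w)"
    and "word_prod (c \<otimes>\<^bsub>G\<^esub> x # w) = c \<otimes>\<^bsub>G\<^esub> word_prod (x # w)"
  using assms amalg_subset_side[of t] subgroup.m_closed[OF side_subgroup[of t]]
  by (auto simp: not_in_amalg_mult G.m_assoc)

definition "reducible g \<longleftrightarrow> g \<in> amalg \<or> (\<exists>t x w. reduced t (x # w) \<and> g = word_prod (x # w))"

text \<open>A letter of \<open>amalg\<close> is absorbed, and any other letter is prepended if it
  comes from the other factor. Otherwise it merges with the first letter; if the result falls into
  \<open>amalg\<close>, the next letter absorbs it.\<close>

lemma reducible_mult_side:
  assumes x: "x \<in> side t" and "reducible g"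
  shows "reducible (x \<otimes>\<^bsub>G\<^esub> g)"
proof -
  have letter: "reducible y" if "y \<in> side t" for y
  proof (cases "y \<in> amalg")
    case False
    with that have "reduced t [y]" "y = word_prod [y]" by auto
    then show ?thesis unfolding reducible_def by blast
  qed (simp add: reducible_def)
  have amalg: "reducible (c \<otimes>\<^bsub>G\<^esub> word_prod (y # w))" if "c \<in> amalg" "reduced s (y # w)" for c s y w
    unfolding reducible_def using reduced_absorb[OF that] by metis
  from assms(2) consider (1) "g \<in> amalg"
    | (2) s y w where "reduced s (y # w)" "g = word_prod (y # w)"
    unfolding reducible_def by blast
  then show ?thesis
  proof cases
    case 1
    then show ?thesis
      using x amalg_subset_side subgroup.m_closed[OF side_subgroup] by (blast intro: letter)
  next
    case 2
    show ?thesis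
    proof (cases "x \<in> amalg \<or> s \<noteq> t")
      case True
      then show ?thesis
      proof
        assume "s \<noteq> t"
        show ?thesis
        proof (cases "x \<in> amalg")
          case False
          with x 2 \<open>s \<noteq> t\<close> have "reduced t (x # y # w)" by (cases s; cases t) auto
          then show ?thesis
            unfolding reducible_def 2(2) by (metis word_prod_simps(2))
        qed (use amalg 2 in simp)
      qed (use amalg 2 in simp)
    next
      case False
      then have y: "y \<in> side t" and w: "reduced (\<not> t) w" using 2 by auto
      have xy: "x \<otimes>\<^bsub>G\<^esub> y \<in> side t" using subgroup.m_closed[OF side_subgroup x y] .
      have eq: "x \<otimes>\<^bsub>G\<^esub> g = x \<otimes>\<^bsub>G\<^esub> y \<otimes>\<^bsub>G\<^esub> word_prod w"
        using x y w by (simp add: 2 G.m_assoc)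
      show ?thesis
      proof (cases "x \<otimes>\<^bsub>G\<^esub> y \<in> amalg")
        case True
        show ?thesis
        proof (cases w)
          case Nil
          then show ?thesis using xy by (simp add: eq letter)
        next
          case (Cons z w')
          then show ?thesis using amalg[OF True] w eq by metis
        qed
      next
        case False
        then have "reduced t (x \<otimes>\<^bsub>G\<^esub> y # w)" using xy w by simp
        then show ?thesis unfolding reducible_def eq by (metis word_prod_simps(2))
      qed
    qed
  qed
qed

lemma reducible:
  assumes "g \<in> carrier G"
  shows "reducible g"
proof -
  define cl where "cl w = rel_closure #>\<^bsub>free_product A B\<^esub> (fp_rel A B `` {w})" for w
  have red: "reducible (cl w)" if "w \<in> fp_words A B" for w
    using that
  proof (induction w)
    case Nil
    have "cl [] = \<one>\<^bsub>G\<^esub>"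
      using FP.coset_mult_one[of rel_closure] normal_imp_subgroup[OF rel_closure_normal, THEN subgroup.subset]
      by (simp add: cl_def free_product_def G_eq)
    then show ?case using subgroup.one_closed[OF amalg_subgroup] by (simp add: reducible_def)
  next
    case (Cons l w)
    then have w: "w \<in> fp_words A B" and l: "[l] \<in> fp_words A B" by (auto simp: fp_words_def)
    have "fp_rel A B `` {[l]} \<in> carrier (free_product A B)"
      "fp_rel A B `` {w} \<in> carrier (free_product A B)"
      using l w by (auto simp: free_product_def quotient_def)
    then have "cl (l # w) = cl [l] \<otimes>\<^bsub>G\<^esub> cl w"
      using hom_mult[OF quotient_hom, of "fp_rel A B `` {[l]}" "fp_rel A B `` {w}"]
        free_product_mult[OF group_A group_B l w]
      by (simp add: cl_def)
    moreover have "\<exists>t. cl [l] \<in> side t"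
    proof (cases l)
      case (Inl a)
      then have "cl [l] \<in> side True" using l by (auto simp: cl_def side_def inl_def fp_inl_def)
      then show ?thesis ..
    next
      case (Inr b)
      then have "cl [l] \<in> side False" using l by (auto simp: cl_def side_def inr_def fp_inr_def)
      then show ?thesis ..
    qed
    ultimately show ?case using Cons.IH[OF w] reducible_mult_side by metis
  qed
  from assms obtain P where "P \<in> carrier (free_product A B)" "g = rel_closure #>\<^bsub>free_product A B\<^esub> P"
    unfolding G_eq carrier_FactGroup by blast
  then obtain w where "w \<in> fp_words A B" "g = cl w"
    by (auto simp: free_product_def quotient_def cl_def)
  with red show ?thesis by blast
qed

section \<open>The derived series of an amalgamated product\<close>

text \<open>The edges of the Bass--Serre tree are the left cosets of \<open>amalg\<close>, and a
  reduced word of length k moves the base edge by k steps. So the condition says that distinct edges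
  at most \<open>L\<close> steps apart remain distinct modulo \<open>N\<close>.\<close>

definition "separates N L \<longleftrightarrow>
  (\<forall>t w. reduced t w \<longrightarrow> w \<noteq> [] \<longrightarrow> length w \<le> L \<longrightarrow>
    N #>\<^bsub>G\<^esub> word_prod w \<notin> (\<lambda>c. N #>\<^bsub>G\<^esub> c) ` amalg)"

lemma separatesD:
  assumes "separates N L" "reduced t w" "w \<noteq> []" "length w \<le> L"
  shows "N #>\<^bsub>G\<^esub> word_prod w \<notin> (\<lambda>c. N #>\<^bsub>G\<^esub> c) ` amalg"
  using assms unfolding separates_def by blast

text \<open>For a word of length L + 1, let p_i be the product of its first i letters. The
  homomorphism \<open>F\<close> records, with signs, the edges p_i E crossed in the quotient. The
  edge p_1 E differs from all the others, since p_1 and any other p_i differ by a reduced word of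
  length at most \<open>L\<close>. This gives a nonzero coordinate, whereas all coordinates vanish
  on \<open>derived G N\<close>.\<close>

lemma separates_derived:
  assumes "N \<lhd> G" "separates N L" "L \<ge> 1"
  shows "separates (derived G N) (Suc L)"
proof -
  let ?Q = "G Mod N" and ?W = "wreath_product integer_group (G Mod N)"
  \<comment> \<open>This keeps the quotient operations abstract, so that simplification uses the
    group laws and not products of sets.\<close>
  note mult_FactGroup [simp del] one_FactGroup [simp del]
  interpret N: normal N G by fact
  interpret N': normal "derived G N" G by (rule G.derived_is_normal[OF assms(1)])
  interpret Q: group ?Q by (rule N.factorgroup_is_group)
  interpret W: group ?W by (intro group_wreath_product group_integer_group Q.group_axioms)
  define q where "q x = N #>\<^bsub>G\<^esub> x" for x
  interpret q: group_hom G ?Q q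
    unfolding q_def by unfold_locales (rule N.r_coset_hom_Mod)
  have q_N: "q g = \<one>\<^bsub>?Q\<^esub>" if "g \<in> N" for g
    using that by (simp add: q_def N.rcos_const[OF G.group_axioms] one_FactGroup)
  define E where "E = q ` amalg"
  interpret E: subgroup E ?Q
    unfolding E_def by (rule q.subgroup_img_is_subgroup[OF amalg_subgroup])
  define e :: "_ \<Rightarrow> int" where "e z = (if z \<in> E then 1 else 0)" for z
  have e_invariant: "e (inv\<^bsub>?Q\<^esub> c \<otimes>\<^bsub>?Q\<^esub> z) = e z" if "c \<in> E" "z \<in> carrier ?Q" for c z
  proof -
    have "z \<in> E" if "inv\<^bsub>?Q\<^esub> c \<otimes>\<^bsub>?Q\<^esub> z \<in> E"
    proof -
      have "c \<otimes>\<^bsub>?Q\<^esub> (inv\<^bsub>?Q\<^esub> c \<otimes>\<^bsub>?Q\<^esub> z) \<in> E" using that \<open>c \<in> E\<close> by (rule E.m_closed[rotated])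
      then show ?thesis using \<open>c \<in> E\<close> \<open>z \<in> carrier ?Q\<close> by (simp flip: Q.m_assoc)
    qed
    then show ?thesis using that by (auto simp: e_def)
  qed
  \<comment> \<open>\<open>\<delta> False\<close> is \<open>\<delta> True\<close> conjugated by the base element \<open>e\<close>; invariance of \<open>e\<close> under \<open>E\<close>
    makes the two agree on the amalgamated subgroup.\<close>
  define \<delta> where "\<delta> t x = (\<lambda>z\<in>carrier ?Q. if t then 0 else e z - e (inv\<^bsub>?Q\<^esub> q x \<otimes>\<^bsub>?Q\<^esub> z), q x)" for t x
  have \<delta>_hom: "\<delta> t \<in> hom G ?W" for t
  proof (rule homI)
    fix x y assume xy: "x \<in> carrier G" "y \<in> carrier G"
    then show "\<delta> t (x \<otimes>\<^bsub>G\<^esub> y) = \<delta> t x \<otimes>\<^bsub>?W\<^esub> \<delta> t y"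
      unfolding \<delta>_def wreath_product_simps
      by (intro prod_eqI) (auto intro!: restrict_ext simp: Q.inv_mult_group Q.m_assoc)
  qed (auto simp: \<delta>_def wreath_product_simps)
  have agree: "\<delta> True c = \<delta> False c" if "c \<in> amalg" for c
    using that e_invariant[of "q c"] by (auto simp: \<delta>_def E_def intro!: restrict_ext)
  obtain F where F: "F \<in> hom G ?W" "\<And>a. a \<in> carrier A \<Longrightarrow> F (inl a) = \<delta> True (inl a)"
    "\<And>b. b \<in> carrier B \<Longrightarrow> F (inr b) = \<delta> False (inr b)"
  proof (rule universal[OF W.group_axioms, of "\<delta> True \<circ> inl" "\<delta> False \<circ> inr"])
    show "(\<delta> True \<circ> inl) c = (\<delta> False \<circ> inr) (\<phi> c)" if "c \<in> C" for c
      using that agree[of "inl c"] by (simp add: amalg_def flip: inl_eq_inr)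
  qed (auto intro: hom_compose inl_hom inr_hom \<delta>_hom)
  interpret F: group_hom G ?W F by unfold_locales (rule F(1))
  have F_side: "F x = \<delta> t x" if "x \<in> side t" for x t
    using that F(2,3) by (cases t) (auto simp: side_def)
  have F_snd: "snd (F g) = q g" if "g \<in> carrier G" for g
  proof -
    have *: "snd (F (word_prod w)) = q (word_prod w)" if "reduced t w" for t w
      using that
    proof (induction w arbitrary: t)
      case (Cons x w)
      then show ?case
        using word_prod_closed[of "\<not> t" w]
        by (auto simp: F_side[of x t] F.hom_mult \<delta>_def wreath_product_mult q.hom_mult)
    qed (simp add: wreath_product_simps)
    have "F c = \<delta> True c" if "c \<in> amalg" for c
      using that amalg_subset_side by (intro F_side) blast
    then show ?thesis
      using reducible[OF that] * unfolding reducible_def by (auto simp: \<delta>_def simp del: reduced.simps word_prod_simps)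
  qed
  \<comment> \<open>Prepending \<open>x\<close> translates the point of evaluation; a letter of the
    second factor also counts the edges E and x E, with opposite signs.\<close>
  have F_Cons: "fst (F (x \<otimes>\<^bsub>G\<^esub> g)) z = (if t then 0 else e z - e (inv\<^bsub>?Q\<^esub> q x \<otimes>\<^bsub>?Q\<^esub> z))
      + fst (F g) (inv\<^bsub>?Q\<^esub> q x \<otimes>\<^bsub>?Q\<^esub> z)"
    if "x \<in> side t" "g \<in> carrier G" "z \<in> carrier ?Q" for x t g z
    using that by (simp add: F.hom_mult F_side[OF that(1)] \<delta>_def wreath_product_mult)
  \<comment> \<open>The last assumption says that \<open>z\<close> lies on no edge of the path of
    \<open>w\<close>, both end edges (k = 0 and k = \<open>length w\<close>) included.\<close>
  have vanish: "fst (F (word_prod w)) z = 0"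
    if "reduced t w" "z \<in> carrier ?Q"
      "\<And>k. k \<le> length w \<Longrightarrow> inv\<^bsub>?Q\<^esub> q (word_prod (take k w)) \<otimes>\<^bsub>?Q\<^esub> z \<notin> E" for t w z
    using that
  proof (induction w arbitrary: t z)
    case Nil
    then show ?case by (simp add: wreath_product_simps)
  next
    case (Cons x w)
    then have x: "x \<in> side t" "x \<in> carrier G" and w: "reduced (\<not> t) w" by auto
    have "inv\<^bsub>?Q\<^esub> q (word_prod (take k w)) \<otimes>\<^bsub>?Q\<^esub> (inv\<^bsub>?Q\<^esub> q x \<otimes>\<^bsub>?Q\<^esub> z) \<notin> E" if "k \<le> length w" for k
      using Cons.prems(3)[of "Suc k"] Cons.prems(2) that x word_prod_closed[OF reduced_take[OF w], of k]
      by (simp add: q.hom_mult Q.inv_mult_group Q.m_assoc)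
    from Cons.IH[OF w _ this] have "fst (F (word_prod w)) (inv\<^bsub>?Q\<^esub> q x \<otimes>\<^bsub>?Q\<^esub> z) = 0"
      using x Cons.prems by simp
    moreover have "z \<notin> E" "inv\<^bsub>?Q\<^esub> q x \<otimes>\<^bsub>?Q\<^esub> z \<notin> E"
      using Cons.prems(3)[of 0] Cons.prems(3)[of 1] Cons.prems(2) x by simp_all
    ultimately show ?case
      using x w Cons.prems(2) by (simp add: F_Cons[of _ t] e_def del: F.hom_mult)
  qed
  have sep: "q (word_prod w) \<notin> E" if "reduced t w" "w \<noteq> []" "length w \<le> L" for t w
    using separatesD[OF assms(2) that] by (simp add: q_def E_def)
  \<comment> \<open>\<open>N\<close> maps into the base group, whose coordinates lie in the abelian
    group of integers.\<close>
  have F_N': "fst (F g) z = 0" if "g \<in> derived G N" "z \<in> carrier ?Q" for g z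
  proof -
    have "snd (F g) = \<one>\<^bsub>?Q\<^esub>" if "g \<in> N" for g
      using that by (simp add: F_snd q_N)
    then have "fst (F g) z \<in> derived integer_group (carrier integer_group)"
      using that
      by (intro wreath_product_derived[where G = G and Q = ?Q and N = N and K = N])
         (auto intro: F N.subgroup_axioms Q.group_axioms)
    also have "\<dots> = {0}"
      using comm_group.derived_eq_singleton[OF abelian_integer_group subset_refl] by simp
    finally show ?thesis by simp
  qed
  have main: "word_prod w \<notin> derived G N" if w: "reduced t w" "length w = Suc L" for t w
  proof
    assume mem: "word_prod w \<in> derived G N"
    obtain x y v where v: "w = x # y # v" using w(2) assms(3) by (cases w; cases "tl w") auto
    then have xy: "x \<in> side t" "x \<in> carrier G" "y \<in> side (\<not> t)" "y \<in> carrier G" "reduced t v"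
      "word_prod v \<in> carrier G"
      using w(1) by auto
    \<comment> \<open>The edge reached after \<open>x\<close> is not met again:
      \<open>y # take k v\<close> is reduced and has at most \<open>L\<close> letters.\<close>
    have notE: "inv\<^bsub>?Q\<^esub> q (word_prod (y # take k v)) \<notin> E" for k
    proof
      assume "inv\<^bsub>?Q\<^esub> q (word_prod (y # take k v)) \<in> E"
      from E.m_inv_closed[OF this] have "q (word_prod (y # take k v)) \<in> E"
        using xy word_prod_closed[OF reduced_take[OF xy(5)], of k] by simp
      moreover have "reduced (\<not> t) (y # take k v)" "length (y # take k v) \<le> L"
        using w v reduced_take[OF xy(5)] by auto
      ultimately show False using sep by blast
    qed
    \<comment> \<open>Translating \<open>q x\<close> back by the first two letters gives the inverse
      of \<open>q y\<close>, where the rest of the word is evaluated.\<close>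
    have "fst (F (word_prod v)) (inv\<^bsub>?Q\<^esub> q y) = 0"
    proof (rule vanish[OF xy(5)])
      fix k
      show "inv\<^bsub>?Q\<^esub> q (word_prod (take k v)) \<otimes>\<^bsub>?Q\<^esub> inv\<^bsub>?Q\<^esub> q y \<notin> E"
        using notE[of k] xy word_prod_closed[OF reduced_take[OF xy(5)], of k]
        by (simp add: q.hom_mult Q.inv_mult_group)
    qed (use xy in simp)
    moreover have "q x \<notin> E"
      using sep[of t "[x]"] w v xy assms(3) by simp
    moreover have "inv\<^bsub>?Q\<^esub> q y \<notin> E"
      using notE[of 0] xy by simp
    \<comment> \<open>Of the edges crossed by the word, only the first one differing from \<open>E\<close>
      contributes at \<open>q x\<close>.\<close>
    ultimately have "fst (F (word_prod w)) (q x) = (if t then 1 else - 1)"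
      using xy E.one_closed
      by (simp add: v F_Cons[of _ t] F_Cons[of _ "\<not> t"] e_def del: F.hom_mult)
    with F_N'[OF mem] xy show False by (simp split: if_splits)
  qed
  show ?thesis
    unfolding separates_def
  proof (intro allI impI notI)
    fix t w assume w: "reduced t w" "w \<noteq> []" "length w \<le> Suc L"
      and "derived G N #>\<^bsub>G\<^esub> word_prod w \<in> (\<lambda>c. derived G N #>\<^bsub>G\<^esub> c) ` amalg"
    then obtain c where c: "c \<in> amalg" "derived G N #>\<^bsub>G\<^esub> word_prod w = derived G N #>\<^bsub>G\<^esub> c" by auto
    \<comment> \<open>The inverse of \<open>c\<close> is absorbed into the first letter of
      \<open>w\<close>, which yields a reduced word of the same length whose product lies in
      \<open>derived G N\<close> itself.\<close>
    have inv_c: "inv\<^bsub>G\<^esub> c \<in> amalg" using c(1) by (rule subgroup.m_inv_closed[OF amalg_subgroup])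
    have "word_prod w \<in> derived G N #>\<^bsub>G\<^esub> c"
      using c(2) w G.rcos_self[OF _ N'.subgroup_axioms, of "word_prod w"] by simp
    then have "word_prod w \<in> c <#\<^bsub>G\<^esub> derived G N"
      using N'.coset_eq c(1) by simp
    then obtain n where n: "n \<in> derived G N" "word_prod w = c \<otimes>\<^bsub>G\<^esub> n" by (auto simp: l_coset_def)
    then have mem: "inv\<^bsub>G\<^esub> c \<otimes>\<^bsub>G\<^esub> word_prod w \<in> derived G N"
      using c(1) N'.mem_carrier[OF n(1)] by (simp flip: G.m_assoc)
    obtain x v where v: "w = x # v" using w(2) by (cases w) auto
    note absorb = reduced_absorb[OF inv_c w(1)[unfolded v]]
    show False
    proof (cases "length w = Suc L")
      case True
      with main[OF absorb(1)] mem show False by (simp only: v absorb(2)) simp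
    next
      case False
      \<comment> \<open>Shorter words are already excluded by the separation property of
        \<open>N\<close>.\<close>
      have "derived G N \<subseteq> N" by (rule G.derived_incl[OF subset_refl N.subgroup_axioms])
      then have "q (inv\<^bsub>G\<^esub> c \<otimes>\<^bsub>G\<^esub> word_prod w) = \<one>\<^bsub>?Q\<^esub>"
        using mem q_N by blast
      then have "q (word_prod (inv\<^bsub>G\<^esub> c \<otimes>\<^bsub>G\<^esub> x # v)) \<in> E"
        using E.one_closed by (simp only: v absorb(2))
      then show False
        using sep[OF absorb(1)] False w(3) v by simp
    qed
  qed
qed

section \<open>A solvable image that is faithful on both factors\<close>

lemma \<phi>_one: "\<phi> \<one> = \<one>\<^bsub>B\<^esub>"
  using \<phi>_mult[of \<one> \<one>] subgroup.one_closed[OF subgroup_C] by simp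

text \<open>The map to the wreath product is the Kaloujnine--Krasner embedding of \<open>A\<close> into
  the wreath product of \<open>C\<close> by \<open>A Mod C\<close>, followed by \<open>\<phi>\<close>. As \<open>A\<close> is abelian, it sends
  \<open>c \<in> C\<close> to the constant function \<open>\<phi> c\<close>, so it is compatible with the diagonal embedding
  of \<open>B\<close>.\<close>

lemma side_meets_derived_trivially:
  assumes "comm_group A" "(derived B ^^ n) (carrier B) = {\<one>\<^bsub>B\<^esub>}"
    and "x \<in> side t" "x \<in> (derived G ^^ Suc n) (carrier G)"
  shows "x = \<one>\<^bsub>G\<^esub>"
proof -
  let ?Q = "A Mod C" and ?W = "wreath_product B (A Mod C)"
  note mult_FactGroup [simp del] one_FactGroup [simp del]
  interpret A: comm_group A by fact
  interpret C: normal C A by (rule A.subgroup_imp_normal[OF subgroup_C])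
  interpret Q: comm_group ?Q by (rule A.abelian_FactGroup[OF subgroup_C])
  interpret W: group ?W by (intro group_wreath_product group_B Q.group_axioms)
  define q where "q a = C #> a" for a
  interpret q: group_hom A ?Q q
    unfolding q_def by unfold_locales (rule C.r_coset_hom_Mod)
  have q_one_iff: "q a = \<one>\<^bsub>?Q\<^esub> \<longleftrightarrow> a \<in> C" if "a \<in> carrier A" for a
    using that A.rcos_self[OF that subgroup_C] C.rcos_const[OF group_A]
    by (auto simp: q_def one_FactGroup)
  define rep where "rep Z = (SOME a. a \<in> carrier A \<and> q a = Z)" for Z
  have rep: "rep Z \<in> carrier A" "q (rep Z) = Z" if "Z \<in> carrier ?Q" for Z
  proof -
    have "\<exists>a. a \<in> carrier A \<and> q a = Z"
      using that by (auto simp: carrier_FactGroup q_def)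
    from someI_ex[OF this] show "rep Z \<in> carrier A" "q (rep Z) = Z" by (simp_all add: rep_def)
  qed
  \<comment> \<open>The cocycle compares the representative of \<open>Z\<close> with the translate
    by \<open>a\<close> of the representative of the coset that \<open>a\<close> carries to
    \<open>Z\<close>. Both lie in \<open>Z\<close>, so its values lie in \<open>C\<close>.\<close>
  define d where "d a Z = inv (rep Z) \<otimes> a \<otimes> rep (inv\<^bsub>?Q\<^esub> q a \<otimes>\<^bsub>?Q\<^esub> Z)" for a Z
  have d_in_C: "d a Z \<in> C" if "a \<in> carrier A" "Z \<in> carrier ?Q" for a Z
  proof -
    have "q (d a Z) = \<one>\<^bsub>?Q\<^esub>"
      using that by (simp add: d_def rep Q.m_assoc flip: Q.m_assoc[of "q a"])
    then show ?thesis using that q_one_iff[of "d a Z"] by (simp add: d_def rep)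
  qed
  have d_mult: "d (a \<otimes> b) Z = d a Z \<otimes> d b (inv\<^bsub>?Q\<^esub> q a \<otimes>\<^bsub>?Q\<^esub> Z)"
    if "a \<in> carrier A" "b \<in> carrier A" "Z \<in> carrier ?Q" for a b Z
  proof -
    define Y where "Y = inv\<^bsub>?Q\<^esub> q a \<otimes>\<^bsub>?Q\<^esub> Z"
    have Y: "Y \<in> carrier ?Q" using that by (simp add: Y_def)
    have "inv\<^bsub>?Q\<^esub> q (a \<otimes> b) \<otimes>\<^bsub>?Q\<^esub> Z = inv\<^bsub>?Q\<^esub> q b \<otimes>\<^bsub>?Q\<^esub> Y"
      using that by (simp add: Y_def Q.inv_mult_group Q.m_assoc)
    then show ?thesis
      using that Y by (simp add: d_def rep A.m_assoc flip: Y_def A.m_assoc[of "rep Y"])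
  qed
  have d_C: "d c Z = c" if "c \<in> C" "Z \<in> carrier ?Q" for c Z
  proof -
    have "inv\<^bsub>?Q\<^esub> q c \<otimes>\<^bsub>?Q\<^esub> Z = Z" using that q_one_iff[of c] by simp
    then show ?thesis
      using that rep[of Z] by (simp add: d_def A.m_comm[of _ c] A.m_assoc)
  qed
  define \<alpha> where "\<alpha> a = (\<lambda>Z\<in>carrier ?Q. \<phi> (d a Z), q a)" for a
  define \<beta> :: "'b \<Rightarrow> _" where "\<beta> b = (\<lambda>Z\<in>carrier ?Q. b, \<one>\<^bsub>?Q\<^esub>)" for b
  have "\<alpha> \<in> hom A ?W"
  proof (rule homI)
    fix a b assume "a \<in> carrier A" "b \<in> carrier A"
    then show "\<alpha> (a \<otimes> b) = \<alpha> a \<otimes>\<^bsub>?W\<^esub> \<alpha> b"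
      unfolding \<alpha>_def wreath_product_simps
      by (intro prod_eqI) (auto intro!: restrict_ext simp: d_mult \<phi>_mult d_in_C)
  qed (auto simp: \<alpha>_def wreath_product_simps d_in_C)
  moreover have "\<beta> \<in> hom B ?W"
    by (rule homI) (auto simp: \<beta>_def wreath_product_simps intro!: restrict_ext)
  moreover have "\<alpha> c = \<beta> (\<phi> c)" if "c \<in> C" for c
    using that q_one_iff[of c] by (auto simp: \<alpha>_def \<beta>_def d_C intro!: restrict_ext)
  ultimately obtain F where F: "F \<in> hom G ?W" "\<And>a. a \<in> carrier A \<Longrightarrow> F (inl a) = \<alpha> a"
    "\<And>b. b \<in> carrier B \<Longrightarrow> F (inr b) = \<beta> b"
    using universal[OF W.group_axioms] by metis
  interpret F: group_hom G ?W F by unfold_locales (rule F(1))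
  interpret s: group_hom G ?Q "\<lambda>g. snd (F g)"
  proof unfold_locales
    show "(\<lambda>g. snd (F g)) \<in> hom G ?Q"
      using F.hom_closed by (intro homI) (auto simp: wreath_product_mult wreath_product_simps(1) mem_Times_iff)
  qed
  let ?D = "derived G (carrier G)"
  have D: "subgroup ?D G" by (rule G.derived_is_subgroup) simp
  \<comment> \<open>As \<open>A Mod C\<close> is abelian, one derived step reaches the base group;
    this accounts for the \<open>Suc\<close> in the index.\<close>
  have snd_one: "snd (F g) = \<one>\<^bsub>?Q\<^esub>" if "g \<in> ?D" for g
  proof -
    have "snd (F g) \<in> derived ?Q ((\<lambda>g. snd (F g)) ` carrier G)"
      using that s.derived_img[of "carrier G"] by blast
    moreover have "(\<lambda>g. snd (F g)) ` carrier G \<subseteq> carrier ?Q"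
      by (intro image_subsetI s.hom_closed)
    ultimately show ?thesis using Q.derived_eq_singleton by blast
  qed
  have sub_D: "(derived G ^^ Suc m) (carrier G) \<subseteq> ?D" for m
    using G.exp_of_derived_in_carrier[of "carrier G" m] by (simp add: G.mono_derived)
  have fst_derived: "fst (F g) z \<in> (derived B ^^ m) (carrier B)"
    if "g \<in> (derived G ^^ Suc m) (carrier G)" "z \<in> carrier ?Q" for g z m
    using that
  proof (induction m arbitrary: g)
    case 0
    then have "F g \<in> carrier ?W" using sub_D[of 0] subgroup.subset[OF D] by auto
    then show ?case using 0 by (auto simp: wreath_product_simps(1) mem_Times_iff dest: PiE_mem)
  next
    case (Suc m)
    have "fst (F g) z \<in> derived B ((derived B ^^ m) (carrier B))"
    proof (rule wreath_product_derived[OF G.group_axioms group_B Q.group_axioms F(1) D snd_one _ sub_D])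
      show "(derived B ^^ m) (carrier B) \<subseteq> carrier B"
        by (rule B.exp_of_derived_in_carrier) simp
    qed (use Suc in auto)
    then show ?case by simp
  qed
  \<comment> \<open>One coordinate suffices, because the functions attached to elements of
    \<open>C\<close> and of \<open>B\<close> are constant.\<close>
  have F_x: "snd (F x) = \<one>\<^bsub>?Q\<^esub>" "fst (F x) \<one>\<^bsub>?Q\<^esub> = \<one>\<^bsub>B\<^esub>"
    using snd_one sub_D assms(4) fst_derived[OF assms(4)] assms(2) by auto
  show ?thesis
  proof (cases t)
    case True
    then obtain a where a: "x = inl a" "a \<in> carrier A" using assms(3) by (auto simp: side_def)
    then have "a \<in> C" using F_x(1) q_one_iff by (simp add: F \<alpha>_def)
    moreover have "\<phi> a = \<phi> \<one>" using F_x(2) a \<open>a \<in> C\<close> by (simp add: F \<alpha>_def d_C \<phi>_one)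
    ultimately have "a = \<one>"
      using inj_onD[OF \<phi>_inj] subgroup.one_closed[OF subgroup_C] by blast
    then show ?thesis using a by simp
  next
    case False
    then obtain b where "x = inr b" "b \<in> carrier B" using assms(3) by (auto simp: side_def)
    then show ?thesis using F_x(2) by (simp add: F \<beta>_def)
  qed
qed

text \<open>Each derived step beyond the index \<open>Suc n\<close> gains one letter, so the product
  of a reduced word of length k lies outside the term of index n + k. Nontrivial elements of
  \<open>amalg\<close> lie in a factor and are outside the term of index
  \<open>Suc n\<close>.\<close>

lemma derived_series_trivial:
  assumes "comm_group A" "nilpotent B" "g \<in> carrier G" "g \<noteq> \<one>\<^bsub>G\<^esub>"
  shows "\<exists>n. g \<notin> (derived G ^^ n) (carrier G)"
proof -
  obtain n where "(derived B ^^ n) (carrier B) = {\<one>\<^bsub>B\<^esub>}"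
    using nilpotent_imp_derived_trivial[OF group_B assms(2)] by blast
  note trivial = side_meets_derived_trivially[OF assms(1) this]
  have sep: "separates ((derived G ^^ (l + Suc n)) (carrier G)) (Suc l)" for l
  proof (induction l)
    case 0
    let ?N = "(derived G ^^ Suc n) (carrier G)"
    interpret N: normal ?N G by (rule G.exp_of_derived_is_normal)
    \<comment> \<open>Both \<open>x\<close> and \<open>c\<close> lie in the image of one factor,
      which meets \<open>?N\<close> trivially, so equal cosets would force x = c.\<close>
    have "?N #>\<^bsub>G\<^esub> x \<noteq> ?N #>\<^bsub>G\<^esub> c" if "x \<in> side t" "x \<notin> amalg" "c \<in> amalg" for x c t
    proof
      assume "?N #>\<^bsub>G\<^esub> x = ?N #>\<^bsub>G\<^esub> c"
      then have "x \<in> ?N #>\<^bsub>G\<^esub> c"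
        using G.rcos_self[OF _ N.subgroup_axioms, of x] that by simp
      then have "x \<otimes>\<^bsub>G\<^esub> inv\<^bsub>G\<^esub> c \<in> ?N"
        using that by (intro N.rcos_module_imp[OF G.group_axioms]) auto
      moreover have "x \<otimes>\<^bsub>G\<^esub> inv\<^bsub>G\<^esub> c \<in> side t"
        using that amalg_subset_side[of t] subgroup.m_closed[OF side_subgroup]
          subgroup.m_inv_closed[OF side_subgroup] by blast
      ultimately have "x \<otimes>\<^bsub>G\<^esub> inv\<^bsub>G\<^esub> c = \<one>\<^bsub>G\<^esub>" by (intro trivial)
      then have "x = c" using that by (simp add: G.inv_solve_right')
      then show False using that by simp
    qed
    then show ?case
      unfolding separates_def by (auto simp: length_Suc_conv le_Suc_eq)
  next
    case (Suc l)
    then show ?case using separates_derived[OF G.exp_of_derived_is_normal Suc] by simp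
  qed
  consider "g \<in> amalg" | t x w where "reduced t (x # w)" "g = word_prod (x # w)"
    using reducible[OF assms(3)] unfolding reducible_def by blast
  then show ?thesis
  proof cases
    case 1
    then show ?thesis using trivial[of g True] amalg_subset_side[of True] assms(4) by blast
  next
    case (2 t x w)
    let ?N = "(derived G ^^ (length w + Suc n)) (carrier G)"
    interpret N: normal ?N G by (rule G.exp_of_derived_is_normal)
    have "?N #>\<^bsub>G\<^esub> g \<noteq> ?N #>\<^bsub>G\<^esub> \<one>\<^bsub>G\<^esub>"
      using separatesD[OF sep[of "length w"] 2(1)] 2(2) subgroup.one_closed[OF amalg_subgroup] by auto
    then have "g \<notin> ?N"
      using N.rcos_const[OF G.group_axioms] N.one_closed by blast
    then show ?thesis by blast
  qed
qed

end

theorem theorem4: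
  fixes A :: "('a, 'm) monoid_scheme" and B :: "('b, 'n) monoid_scheme"
    and C\<^sub>A :: "'a set" and C\<^sub>B :: "'b set" and \<phi> :: "'a \<Rightarrow> 'b"
  assumes "comm_group A" and "finitely_generated A" and "torsion_free A"
    and "group B" and "nilpotent B"
    and "subgroup C\<^sub>A A" and "subgroup C\<^sub>B B"
    and "\<phi> \<in> iso (A\<lparr>carrier := C\<^sub>A\<rparr>) (B\<lparr>carrier := C\<^sub>B\<rparr>)"
  shows "residually_solvable_by_abelian_by_finite_abelian (amalgamated_product A B C\<^sub>A \<phi>)
    \<and> residually_solvable (amalgamated_product A B C\<^sub>A \<phi>)"
proof -
  interpret amalgam A B C\<^sub>A C\<^sub>B \<phi>
    using assms by (simp add: amalgam_def comm_group.axioms(2))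
  note series = derived_series_trivial[OF assms(1,5)]
  have "residually_solvable (G\<lparr>carrier := derived G (carrier G)\<rparr>)"
    by (rule G.residually_solvable_subgroup[OF series G.derived_is_subgroup]) auto
  then show ?thesis
    using G.residually_solvable_by_abelian_by_finite_abelianI
      G.residually_solvable_if_derived[OF series] by blast
qed

end
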